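(* Let $r, d$ be positive integers, $n = (r-1)(d+1)$, and let $X = \{x_1,\ldots,x_r\}$ be a set of $r$ points in $\mathbb{R}^d$. Let $v_1,\ldots,v_r\in\mathbb{R}^{r-1}$ be vectors such that $\sum_{i=1}^r v_i = 0$ is, up to scalar multiples, their unique linear dependence; for $x\in\mathbb{R}^d$ let $\overline{x} = (x,1)\in\mathbb{R}^{d+1}$, and identify the $(r-1)\times(d+1)$ matrix $v_i\otimes\overline{x} = v_i\overline{x}^T$ with a point of $\mathbb{R}^n$. Let $H$ be a closed half-space in $\mathbb{R}^n$ whose boundary hyperplane contains the origin, and let $T$ be the $r\times r$ $\{0,1\}$-matrix with $T(i,j) = 1$ if $v_i\otimes\overline{x_j}\in H$ and $T(i,j)=0$ otherwise. Then: (1) each column $j$ of $T$ has at least one nonzero entry; (2) there exist $d+1$ rows $i_1,\ldots,i_{d+1}$ such that each column $j$ has at least one nonzero entry among $T(i_1,j),\ldots,T(i_{d+1},j)$. *)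

theory Defs
  imports Complex_Main "Jordan_Normal_Form.Matrix"
begin

text \<open>
  Vectors and matrices are those of \<^theory>\<open>Jordan_Normal_Form.Matrix\<close>: the space of real
  \<open>m\<close>-vectors is \<open>carrier_vec m\<close>, and \<open>m = 0\<close> is allowed. All indices start at \<open>0\<close>.
\<close>

definition homogenize :: "real vec \<Rightarrow> real vec" where
  "homogenize x = x @\<^sub>v vec 1 (\<lambda>_. 1)"

definition outer_product :: "real vec \<Rightarrow> real vec \<Rightarrow> real mat" where
  "outer_product v w = mat (dim_vec v) (dim_vec w) (\<lambda>(i, k). v $ i * w $ k)"

text \<open>The identification of \<open>p \<times> q\<close> matrices with vectors of dimension \<open>p * q\<close>, row by row.\<close>

definition vec_of_mat :: "real mat \<Rightarrow> real vec" where
  "vec_of_mat A = vec (dim_row A * dim_col A) (\<lambda>k. A $$ (k div dim_col A, k mod dim_col A))"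

definition tensor_point :: "real vec \<Rightarrow> real vec \<Rightarrow> real vec" where
  "tensor_point v x = vec_of_mat (outer_product v (homogenize x))"

text \<open>
  The sum vanishes, and every linear dependence is a scalar multiple of it, i.e. has constant
  coefficients.
\<close>

definition sum_is_unique_dependence :: "nat \<Rightarrow> nat \<Rightarrow> (nat \<Rightarrow> real vec) \<Rightarrow> bool" where
  "sum_is_unique_dependence m r v \<longleftrightarrow>
     finsum_vec TYPE(real) m v {..<r} = 0\<^sub>v m \<and>
     (\<forall>c :: nat \<Rightarrow> real.
        finsum_vec TYPE(real) m (\<lambda>i. c i \<cdot>\<^sub>v v i) {..<r} = 0\<^sub>v m \<longrightarrow>
        (\<exists>t. \<forall>i<r. c i = t))"

definition hyperplane :: "nat \<Rightarrow> real vec \<Rightarrow> real \<Rightarrow> real vec set" where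
  "hyperplane n a b = {y \<in> carrier_vec n. a \<bullet> y = b}"

text \<open>For \<open>a \<noteq> 0\<close>, the closed half-space with boundary \<open>hyperplane n a b\<close> and outer normal \<open>a\<close>.\<close>

definition closed_halfspace :: "nat \<Rightarrow> real vec \<Rightarrow> real \<Rightarrow> real vec set" where
  "closed_halfspace n a b = {y \<in> carrier_vec n. a \<bullet> y \<le> b}"

definition incidence_matrix ::
  "nat \<Rightarrow> (nat \<Rightarrow> real vec) \<Rightarrow> (nat \<Rightarrow> real vec) \<Rightarrow> real vec set \<Rightarrow> nat mat" where
  "incidence_matrix r v x H = mat r r (\<lambda>(i, j). if tensor_point (v i) (x j) \<in> H then 1 else 0)"

end

theory Submission
  imports Defs "Jordan_Normal_Form.Determinant"
begin

text \<open>
  Contracting the normal vector \<open>a\<close> with \<open>v\<^sub>i\<close> gives vectors \<open>w\<^sub>i\<close> in \<open>\<real>\<^sup>d\<^sup>+\<^sup>1\<close> whose sum is zero, and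
  \<open>T(i,j) = 1\<close> iff \<open>w\<^sub>i \<bullet> (x\<^sub>j,1) \<le> 0\<close>. Hence (1). For (2), a basic-solution (Caratheodory) argument
  reduces the relation \<open>\<Sum>\<^sub>i w\<^sub>i = 0\<close> to nonnegative weights, not all zero, on at most \<open>d + 1\<close> indices,
  for which the first \<open>d\<close> coordinates still cancel and the last one is at most \<open>0\<close>. This weaker
  condition is what brings the Caratheodory number down from \<open>d + 2\<close> to \<open>d + 1\<close>, and it still makes
  the weighted sum of the values \<open>w\<^sub>i \<bullet> (x\<^sub>j,1)\<close> nonpositive for every \<open>j\<close>.
\<close>

text \<open>Fewer homogeneous equations than unknowns: the system embeds into a singular square
  matrix, and a kernel vector gives the coefficients.\<close>

lemma exists_nontrivial_relation:
  fixes f :: "nat \<Rightarrow> 'a \<Rightarrow> 'b::field"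
  assumes "finite S" and "m < card S"
  obtains \<mu> where "\<exists>i\<in>S. \<mu> i \<noteq> 0" and "\<And>k. k < m \<Longrightarrow> (\<Sum>i\<in>S. \<mu> i * f k i) = 0"
proof -
  define N where "N = card S"
  obtain h where h: "bij_betw h {0..<N} S"
    using assms(1) ex_bij_betw_nat_finite unfolding N_def by blast
  define c where "c = (\<lambda>k. vec N (\<lambda>i. f k (h i)))"
  \<comment> \<open>The rows before \<open>m\<close> are the equations. Row \<open>m\<close> exists
    because \<open>m < N\<close>, and being zero it makes the determinant vanish whatever the later
    rows contain.\<close>
  define A where "A = mat\<^sub>r N N (\<lambda>k. if k = m then 0\<^sub>v N else c k)"
  have A: "A \<in> carrier_mat N N"
    by (simp add: A_def)
  have "det A = 0"
    unfolding A_def using assms(2) by (intro det_row_0) (auto simp: c_def N_def)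
  then obtain u where u: "u \<in> carrier_vec N" "u \<noteq> 0\<^sub>v N" "A *\<^sub>v u = 0\<^sub>v N"
    using det_0_iff_vec_prod_zero_field[OF A] by blast
  define g where "g = inv_into {0..<N} h"
  have g: "g (h i) = i" if "i < N" for i
    using h that unfolding g_def bij_betw_def by (simp add: inv_into_f_f)
  have "\<exists>i<N. u $ i \<noteq> 0"
    using u(1,2) by (auto intro!: eq_vecI)
  then obtain i where i: "i < N" "u $ i \<noteq> 0"
    by blast
  show thesis
  proof
    show "\<exists>i\<in>S. u $ g i \<noteq> 0"
      using i g h by (intro bexI[of _ "h i"]) (auto simp: bij_betw_def)
    fix k assume k: "k < m"
    then have kN: "k < N"
      using assms(2) by (simp add: N_def)
    have "(\<Sum>i\<in>S. u $ g i * f k i) = (\<Sum>i = 0..<N. u $ g (h i) * f k (h i))"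
      using sum.reindex_bij_betw[OF h, of "\<lambda>i. u $ g i * f k i"] by simp
    also have "\<dots> = (\<Sum>i = 0..<N. f k (h i) * u $ i)"
      by (intro sum.cong) (auto simp: g mult.commute)
    also have "\<dots> = (A *\<^sub>v u) $ k"
      using k kN u(1) by (auto simp: A_def c_def scalar_prod_def intro!: sum.cong)
    finally show "(\<Sum>i\<in>S. u $ g i * f k i) = 0"
      using u(3) kN by simp
  qed
qed

text \<open>One pivoting argument of linear programming: \<open>c\<close> is an objective, not an
  equation, so only the \<open>m\<close> equations and the total weight have to be preserved. On
  more than \<open>m + 1\<close> indices there is a direction preserving these; following it until
  some weight reaches zero removes an index.\<close>

lemma exists_basic_solution:
  fixes f :: "nat \<Rightarrow> 'a \<Rightarrow> 'b::linordered_field" and c \<rho> :: "'a \<Rightarrow> 'b"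
  assumes "finite S"
    and "\<And>i. i \<in> S \<Longrightarrow> 0 \<le> \<rho> i" and "0 < sum \<rho> S"
    and "\<And>k. k < m \<Longrightarrow> (\<Sum>i\<in>S. \<rho> i * f k i) = 0"
    and "(\<Sum>i\<in>S. \<rho> i * c i) \<le> 0"
  shows "\<exists>B \<nu>. B \<subseteq> S \<and> card B \<le> m + 1 \<and> (\<forall>i\<in>B. 0 \<le> \<nu> i) \<and> 0 < sum \<nu> B \<and>
    (\<forall>k<m. (\<Sum>i\<in>B. \<nu> i * f k i) = 0) \<and> (\<Sum>i\<in>B. \<nu> i * c i) \<le> 0"
  using assms
proof (induction S arbitrary: \<rho> rule: finite_psubset_induct)
  case (psubset S)
  show ?case
  proof (cases "card S \<le> m + 1")
    case True
    then show ?thesis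
      using psubset.prems by blast
  next
    case False
    \<comment> \<open>The extra row of ones, at \<open>k = m\<close>, forces the coefficients to sum
      to zero, so the total weight stays positive.\<close>
    then obtain \<mu>' where \<mu>': "\<exists>i\<in>S. \<mu>' i \<noteq> 0"
      "\<And>k. k < m + 1 \<Longrightarrow> (\<Sum>i\<in>S. \<mu>' i * (if k < m then f k i else 1)) = 0"
      using exists_nontrivial_relation[of S "m + 1" "\<lambda>k i. if k < m then f k i else 1"]
        psubset.hyps by (metis not_le)
    \<comment> \<open>Orients the direction so that the objective does not increase.\<close>
    define \<epsilon> :: 'b where "\<epsilon> = (if (\<Sum>i\<in>S. \<mu>' i * c i) \<le> 0 then 1 else -1)"
    define \<mu> where "\<mu> i = \<epsilon> * \<mu>' i" for i
    have \<mu>_sum: "(\<Sum>i\<in>S. \<mu> i * e i) = \<epsilon> * (\<Sum>i\<in>S. \<mu>' i * e i)" for e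
      by (simp add: \<mu>_def sum_distrib_left mult.assoc)
    have \<mu>_f: "(\<Sum>i\<in>S. \<mu> i * f k i) = 0" if "k < m" for k
      using \<mu>'(2)[of k] that by (simp add: \<mu>_sum)
    have \<mu>_1: "sum \<mu> S = 0"
      using \<mu>'(2)[of m] \<mu>_sum[of "\<lambda>_. 1"] by simp
    have \<mu>_c: "(\<Sum>i\<in>S. \<mu> i * c i) \<le> 0"
      by (simp add: \<mu>_sum \<epsilon>_def)
    have \<mu>_nz: "\<exists>i\<in>S. \<mu> i \<noteq> 0"
      using \<mu>'(1) by (auto simp: \<mu>_def \<epsilon>_def)
    define Neg where "Neg = {i \<in> S. \<mu> i < 0}"
    have "Neg \<noteq> {}"
    proof
      assume "Neg = {}"
      then have "\<forall>i\<in>S. 0 \<le> \<mu> i"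
        by (auto simp: Neg_def not_less)
      then show False
        using \<mu>_1 \<mu>_nz psubset.hyps sum_nonneg_eq_0_iff[of S \<mu>] by blast
    qed
    moreover have "finite Neg"
      using psubset.hyps by (simp add: Neg_def)
    \<comment> \<open>Ratio test: the least ratio is the largest step that keeps all weights
      nonnegative, and at that step the weight of \<open>p\<close> is exactly zero.\<close>
    ultimately obtain p where p: "p \<in> Neg"
      and p_min: "\<And>i. i \<in> Neg \<Longrightarrow> \<rho> p / - \<mu> p \<le> \<rho> i / - \<mu> i"
      using arg_min_if_finite[of Neg "\<lambda>i. \<rho> i / - \<mu> i"] by (metis not_le)
    define t where "t = \<rho> p / - \<mu> p"
    have pS: "p \<in> S" "\<mu> p < 0"
      using p by (auto simp: Neg_def)
    have t: "0 \<le> t"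
      unfolding t_def using pS psubset.prems(1) by (intro divide_nonneg_pos) auto
    define \<nu> where "\<nu> i = \<rho> i + t * \<mu> i" for i
    have \<nu>_p: "\<nu> p = 0"
      using pS by (simp add: \<nu>_def t_def)
    have \<nu>_nonneg: "0 \<le> \<nu> i" if i: "i \<in> S" for i
    proof (cases "\<mu> i < 0")
      case True
      then have "t \<le> \<rho> i / - \<mu> i"
        using p_min[of i] i by (simp add: Neg_def t_def)
      then have "t * - \<mu> i \<le> \<rho> i"
        using True by (subst (asm) pos_le_divide_eq) auto
      then show ?thesis
        by (simp add: \<nu>_def)
    next
      case False
      then show ?thesis
        using t i psubset.prems(1) by (simp add: \<nu>_def)
    qed
    \<comment> \<open>Taking \<open>e\<close> to be \<open>f k\<close>, \<open>c\<close> and the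
      constant 1 yields the equations, the objective and the total weight on the smaller
      set.\<close>
    have \<nu>_sum: "(\<Sum>i\<in>S - {p}. \<nu> i * e i)
        = (\<Sum>i\<in>S. \<rho> i * e i) + t * (\<Sum>i\<in>S. \<mu> i * e i)" for e
    proof -
      have "(\<Sum>i\<in>S - {p}. \<nu> i * e i) = (\<Sum>i\<in>S. \<nu> i * e i)"
        using psubset.hyps pS \<nu>_p by (simp add: sum_diff1)
      then show ?thesis
        by (simp add: \<nu>_def algebra_simps sum.distrib sum_distrib_left)
    qed
    have "\<exists>B \<nu>. B \<subseteq> S - {p} \<and> card B \<le> m + 1 \<and> (\<forall>i\<in>B. 0 \<le> \<nu> i) \<and> 0 < sum \<nu> B \<and>
      (\<forall>k<m. (\<Sum>i\<in>B. \<nu> i * f k i) = 0) \<and> (\<Sum>i\<in>B. \<nu> i * c i) \<le> 0"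
    proof (rule psubset.IH)
      show "S - {p} \<subset> S"
        using pS by blast
      show "0 < sum \<nu> (S - {p})"
        using \<nu>_sum[of "\<lambda>_. 1"] \<mu>_1 psubset.prems(2) by simp
      show "(\<Sum>i\<in>S - {p}. \<nu> i * c i) \<le> 0"
        using psubset.prems(4) mult_nonneg_nonpos[OF t \<mu>_c] by (simp add: \<nu>_sum)
    qed (use \<nu>_nonneg \<nu>_sum \<mu>_f psubset.prems(3) in auto)
    then show ?thesis
      by blast
  qed
qed

text \<open>Matrix entry \<open>(l, k)\<close> sits at index \<open>l * (d + 1) + k\<close>, so the
  sum splits into blocks, one per row. Swapping the sums contracts \<open>a\<close> with
  \<open>u\<close>; the constant term comes from the homogenizing coordinate 1 in column
  \<open>d\<close>.\<close>

lemma scalar_prod_tensor_point: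
  assumes "a \<in> carrier_vec (p * (d + 1))" and "u \<in> carrier_vec p" and "y \<in> carrier_vec d"
  shows "a \<bullet> tensor_point u y
    = (\<Sum>k<d. (\<Sum>l<p. a $ (l * (d + 1) + k) * u $ l) * y $ k) + (\<Sum>l<p. a $ (l * (d + 1) + d) * u $ l)"
proof -
  let ?q = "d + 1"
  let ?h = "homogenize y"
  have h: "dim_vec ?h = ?q" "?h $ d = 1" "\<And>k. k < d \<Longrightarrow> ?h $ k = y $ k"
    using assms(3) by (auto simp: homogenize_def)
  have u: "dim_vec u = p"
    using assms(2) by simp
  have bound: "l * ?q + k < p * ?q" if "l < p" "k < ?q" for l k
  proof -
    have "l * ?q + k < Suc l * ?q"
      using that by simp
    also have "\<dots> \<le> p * ?q"
      using that by (intro mult_right_mono) auto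
    finally show ?thesis .
  qed
  have entry: "tensor_point u y $ (l * ?q + k) = u $ l * ?h $ k" if "l < p" "k < ?q" for l k
  proof -
    have "(l * ?q + k) div ?q = l" "(l * ?q + k) mod ?q = k"
      using that by (simp_all only: div_mult_self3 mod_mult_self3 div_less mod_less)
    then show ?thesis
      using bound[OF that] that h(1) u
      by (simp add: tensor_point_def vec_of_mat_def outer_product_def del: add_Suc_right mult_Suc_right)
  qed
  have "a \<bullet> tensor_point u y = (\<Sum>i<p * ?q. a $ i * tensor_point u y $ i)"
    by (simp add: scalar_prod_def tensor_point_def vec_of_mat_def outer_product_def h u
        atLeast0LessThan)
  also have "\<dots> = (\<Sum>l<p. \<Sum>i = l * ?q..<l * ?q + ?q. a $ i * tensor_point u y $ i)"
    by (rule sum.nat_group[symmetric])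
  also have "\<dots> = (\<Sum>l<p. \<Sum>k<?q. a $ (l * ?q + k) * tensor_point u y $ (l * ?q + k))"
  proof (rule sum.cong[OF refl])
    fix l
    show "(\<Sum>i = l * ?q..<l * ?q + ?q. a $ i * tensor_point u y $ i)
        = (\<Sum>k<?q. a $ (l * ?q + k) * tensor_point u y $ (l * ?q + k))"
      using sum.shift_bounds_nat_ivl[of "\<lambda>i. a $ i * tensor_point u y $ i" 0 "l * ?q" ?q]
      by (simp only: add.commute[of _ "l * ?q"] add_0_right atLeast0LessThan)
  qed
  also have "\<dots> = (\<Sum>l<p. \<Sum>k<?q. a $ (l * ?q + k) * u $ l * ?h $ k)"
    by (intro sum.cong refl) (use entry in \<open>simp add: mult.assoc\<close>)
  also have "\<dots> = (\<Sum>k<?q. (\<Sum>l<p. a $ (l * ?q + k) * u $ l) * ?h $ k)"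
    by (subst sum.swap) (simp add: sum_distrib_right)
  also have "\<dots> = (\<Sum>k<d. (\<Sum>l<p. a $ (l * ?q + k) * u $ l) * y $ k) + (\<Sum>l<p. a $ (l * ?q + d) * u $ l)"
    using h(2,3) by simp
  finally show ?thesis .
qed

lemma exists_nonpos_of_weighted_sum_nonpos:
  fixes \<nu> g :: "'a \<Rightarrow> 'b::linordered_field"
  assumes "finite B" and "\<And>i. i \<in> B \<Longrightarrow> 0 \<le> \<nu> i" and "0 < sum \<nu> B"
    and "(\<Sum>i\<in>B. \<nu> i * g i) \<le> 0"
  shows "\<exists>i\<in>B. g i \<le> 0"
proof (rule ccontr)
  assume "\<not> (\<exists>i\<in>B. g i \<le> 0)"
  then have pos: "\<And>i. i \<in> B \<Longrightarrow> 0 < g i"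
    by force
  obtain p where p: "p \<in> B" "0 < \<nu> p"
    using assms(3) sum_nonpos[of B \<nu>] by (meson not_le)
  have "0 < (\<Sum>i\<in>B. \<nu> i * g i)"
    using assms(1,2) p pos
    by (intro sum_pos2[of B p]) (auto simp: less_imp_le)
  then show False
    using assms(4) by simp
qed

theorem theorem5p2:
  fixes r d n :: nat
    and x v :: "nat \<Rightarrow> real vec"
    and a :: "real vec" and b :: real and H :: "real vec set"
    and T :: "nat mat"
  assumes "r > 0" and "d > 0"
    and "n = (r - 1) * (d + 1)"
    and "\<And>j. j < r \<Longrightarrow> x j \<in> carrier_vec d"
    and "inj_on x {..<r}"
    and "\<And>i. i < r \<Longrightarrow> v i \<in> carrier_vec (r - 1)"
    and "sum_is_unique_dependence (r - 1) r v"
    and "a \<in> carrier_vec n" and "a \<noteq> 0\<^sub>v n"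
    and "H = closed_halfspace n a b"
    and "0\<^sub>v n \<in> hyperplane n a b"
    and "T = incidence_matrix r v x H"
  shows "(\<forall>j<r. \<exists>i<r. T $$ (i, j) \<noteq> 0) \<and>
    (\<exists>i :: nat \<Rightarrow> nat. (\<forall>k<d + 1. i k < r) \<and>
       (d + 1 \<le> r \<longrightarrow> inj_on i {..<d + 1}) \<and>
       (\<forall>j<r. \<exists>k<d + 1. T $$ (i k, j) \<noteq> 0))"
proof -
  have r: "0 < r" by fact
  have b: "b = 0"
    using assms(8,11) by (simp add: hyperplane_def)
  define w where "w k i = (\<Sum>l<r - 1. a $ (l * (d + 1) + k) * v i $ l)" for k i
  define g where "g i j = (\<Sum>k<d. w k i * x j $ k) + w d i" for i j
  have T_iff: "T $$ (i, j) \<noteq> 0 \<longleftrightarrow> g i j \<le> 0" if "i < r" "j < r" for i j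
  proof -
    have "tensor_point (v i) (x j) \<in> carrier_vec n"
      using assms(3) assms(4)[OF that(2)] assms(6)[OF that(1)]
      by (simp add: tensor_point_def vec_of_mat_def outer_product_def homogenize_def)
    moreover have "a \<bullet> tensor_point (v i) (x j) = g i j"
      using scalar_prod_tensor_point[of a "r - 1" d "v i" "x j"] assms(3,8)
        assms(4)[OF that(2)] assms(6)[OF that(1)]
      by (simp add: g_def w_def)
    ultimately show ?thesis
      using that b assms(10,12) by (simp add: incidence_matrix_def closed_halfspace_def)
  qed
  have v_sum: "(\<Sum>i<r. v i $ l) = 0" if "l < r - 1" for l
  proof -
    have "(\<Sum>i<r. v i $ l) = finsum_vec TYPE(real) (r - 1) v {..<r} $ l"
      using that assms(6) by (subst index_finsum_vec) auto
    then show ?thesis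
      using assms(7) that by (simp add: sum_is_unique_dependence_def)
  qed
  have w_sum: "(\<Sum>i<r. w k i) = 0" for k
    unfolding w_def by (subst sum.swap) (simp add: sum_distrib_left[symmetric] v_sum)
  have g_sum: "(\<Sum>i\<in>B. \<nu> i * g i j)
      = (\<Sum>k<d. (\<Sum>i\<in>B. \<nu> i * w k i) * x j $ k) + (\<Sum>i\<in>B. \<nu> i * w d i)" for \<nu> B j
    by (simp add: g_def distrib_left sum.distrib sum_distrib_left sum_distrib_right mult.assoc
        sum.swap[of _ B])
  \<comment> \<open>Part (1): with unit weights all coordinates cancel, so the values
    \<open>g i j\<close> sum to zero over \<open>i\<close>.\<close>
  have "\<exists>i<r. T $$ (i, j) \<noteq> 0" if "j < r" for j
    using exists_nonpos_of_weighted_sum_nonpos[of "{..<r}" "\<lambda>_. 1" "\<lambda>i. g i j"]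
      g_sum[of "\<lambda>_. 1" j "{..<r}"] T_iff that r by (auto simp: w_sum)
  moreover
  \<comment> \<open>Coordinates below \<open>d\<close> are the equations and coordinate
    \<open>d\<close> is the objective. No \<open>x j\<close> enters, so a single \<open>B\<close>
    serves all columns.\<close>
  obtain B \<nu> where B: "B \<subseteq> {..<r}" "card B \<le> d + 1" "\<forall>i\<in>B. 0 \<le> \<nu> i" "0 < sum \<nu> B"
    "\<forall>k<d. (\<Sum>i\<in>B. \<nu> i * w k i) = 0" "(\<Sum>i\<in>B. \<nu> i * w d i) \<le> 0"
    using exists_basic_solution[of "{..<r}" "\<lambda>_. 1" d w "w d"] r by (auto simp: w_sum)
  have cover: "\<exists>i\<in>B. T $$ (i, j) \<noteq> 0" if "j < r" for j
  proof -
    have "\<exists>i\<in>B. g i j \<le> 0"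
      using B finite_subset[OF B(1)]
      by (intro exists_nonpos_of_weighted_sum_nonpos[of B \<nu>]) (auto simp: g_sum)
    then show ?thesis
      using T_iff that B(1) by blast
  qed
  \<comment> \<open>\<open>B\<close> may have fewer than \<open>d + 1\<close> elements. If there are
    enough rows it is enlarged to exactly \<open>d + 1\<close> of them; otherwise all rows are
    listed, with row 0 repeated as filler.\<close>
  have "\<exists>i :: nat \<Rightarrow> nat. i ` {..<d + 1} \<subseteq> {..<r} \<and> (d + 1 \<le> r \<longrightarrow> inj_on i {..<d + 1}) \<and>
    B \<subseteq> i ` {..<d + 1}"
  proof (cases "d + 1 \<le> r")
    case True
    then obtain C where C: "B \<subseteq> C" "C \<subseteq> {..<r}" "card C = d + 1"
      using exists_subset_between[of B "d + 1" "{..<r}"] B(1,2) by auto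
    then obtain i where "bij_betw i {0..<d + 1} C"
      using ex_bij_betw_nat_finite[of C] finite_subset by (metis finite_lessThan)
    then show ?thesis
      using C by (auto simp: bij_betw_def atLeast0LessThan)
  next
    case False
    then show ?thesis
      using B(1) r by (intro exI[of _ "\<lambda>k. if k < r then k else 0"]) force
  qed
  then obtain i :: "nat \<Rightarrow> nat" where i: "i ` {..<d + 1} \<subseteq> {..<r}"
    "d + 1 \<le> r \<longrightarrow> inj_on i {..<d + 1}" "B \<subseteq> i ` {..<d + 1}"
    by blast
  have "\<exists>k<d + 1. T $$ (i k, j) \<noteq> 0" if "j < r" for j
    using cover[OF that] i(3) by blast
  moreover have "\<forall>k<d + 1. i k < r"
    using i(1) by blast
  ultimately show ?thesis
    using i(2) by blast
qed

end
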